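(* Let $g$ be a simplest rational element of $\Lambda_-^{\tau,\sigma}\mathrm{GL}(3,\mathbb{C})$. Then there exist $\alpha\in\mathbb{R}\setminus\{0\}$ and a real line $\ell=\mathbb{R}\cdot(a,b,1)\subset\mathbb{R}^3$ with $\ell\nsubseteq\Delta_0$ (equivalently, $a,b\in\mathbb{R}$ with $2ab\neq1$) such that either $g=g_{\alpha,\ell}$ (rank 1 type) or $g=h_{\alpha,\ell}$ (rank 2 type).
   Context: Notation. $\mathbb{C}_*=\mathbb{C}\setminus\{0\}$, $\epsilon=e^{\pi i/3}$. $\mathcal{O}_r=\{|\lambda|<r\}$, $\mathcal{O}_{1/r}=\{\lambda\in\mathbb{C}\cup\{\infty\}:|\lambda|>1/r\}$, where $0<r<1$ is sufficiently small (depending on the element considered). For a matrix group $G$, $\Lambda_-G$ is the set of holomorphic maps $f:\mathcal{O}_r\cup\mathcal{O}_{1/r}\to G$ with $f(\infty)=I$. For an invertible $3\times 3$ matrix $g$ put $\sigma(g)=T(g^t)^{-1}T^{-1}$ with $T=\begin{pmatrix}0&1&0\\-\epsilon&0&0\\0&0&\epsilon^2\end{pmatrix}$, and $\tau(g)=\bar g$. $\Lambda_-^{\tau,\sigma}G$ is the subgroup of $g\in\Lambda_-G$ with $\overline{g(\bar\lambda)}=g(\lambda)$ and $\sigma(g(\lambda))=g(\epsilon\lambda)$. The $\sigma$-condition is equivalent to $Qg(\lambda)Q^{-1}=g(\epsilon^4\lambda)$ and $P(g(\lambda)^t)^{-1}P=g(-\lambda)$, where $Q=\mathrm{diag}(\epsilon^4,\epsilon^2,1)$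 and $P=\begin{pmatrix}0&1&0\\1&0&0\\0&0&1\end{pmatrix}$. A simplest rational element of $\Lambda_-^{\tau,\sigma}\mathrm{GL}(3,\mathbb{C})$ is an element that is rational in $\lambda$, whose only poles are three simple poles at $\beta,\epsilon^2\beta,\epsilon^4\beta$ for some $\beta\in\mathbb{C}_*$, and that is nontrivial, i.e. not the scalar element $\frac{\lambda^3+\beta^3}{\lambda^3-\beta^3}I$. $\Delta=\{(z_1,z_2,z_3)\in\mathbb{C}^3: 2z_1z_2=z_3^2\text{ or }z_3=0\}$ and $\Delta_0=\Delta\cap\mathbb{R}^3$. For $\alpha\in\mathbb{R}\setminus\{0\}$ and a real line $\ell=\mathbb{R}\cdot(a,b,1)\nsubseteq\Delta_0$: $$g_{\alpha,\ell}(\lambda)=I+\frac{2}{\lambda^3-\alpha^3}\begin{pmatrix}\frac{\alpha^3ab}{2ab-1}&\frac{\alpha\lambda^2b^2}{2ab-1}&\frac{\alpha^2\lambda b}{2ab-1}\\ \alpha^2\lambda a^2&\alpha^3ab&\alpha\lambda^2a\\ \alpha\lambda^2a&\alpha^2\lambda b&\alpha^3\end{pmatrix},$$ $$h_{\alpha,\ell}(\lambda)=I+\frac{2}{\lambda^3-\alpha^3}\begin{pmatrix}\frac{\alpha^3(ab-1)}{2ab-1}&\frac{-\alpha\lambda^2b^2}{2ab-1}&\frac{\alpha^2\lambda b}{2ab-1}\\ \alpha^2\lambda a^2&\alpha^3(1-ab)&-\alpha\lambda^2a\\ -\alpha\lambda^2a&\alpha^2\lambda b&0\end{pmatrix}.$$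 *)

theory Defs
  imports "HOL-Complex_Analysis.Complex_Analysis"
begin

definition eps :: complex where
  "eps = exp (of_real pi * \<i> / 3)"

definition T_mat :: "complex^3^3" where
  "T_mat = vector [vector [0, 1, 0],
                   vector [- eps, 0, 0],
                   vector [0, 0, eps^2]]"

definition sigma :: "complex^3^3 \<Rightarrow> complex^3^3" where
  "sigma A = T_mat ** matrix_inv (transpose A) ** matrix_inv T_mat"

definition tau :: "complex^3^3 \<Rightarrow> complex^3^3" where
  "tau A = map_matrix cnj A"

definition GL3 :: "(complex^3^3) set" where
  "GL3 = {A. invertible A}"

text \<open>The finite points of the union of the disc around 0 and the disc around infinity.\<close>

definition loop_domain :: "real \<Rightarrow> complex set" where
  "loop_domain r = {z. norm z < r} \<union> {z. norm z > 1 / r}"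

text \<open>Maps on a neighbourhood of 0 and infinity in the Riemann sphere are encoded by functions on
  the complex plane, whose values outside the loop domain are irrelevant. The value at infinity
  is fixed to be the identity; holomorphy on the disc around infinity is expressed in the chart
  w = 1 / z, in which the point infinity corresponds to w = 0.\<close>

definition infinity_chart :: "(complex \<Rightarrow> complex^3^3) \<Rightarrow> complex \<Rightarrow> complex^3^3" where
  "infinity_chart f w = (if w = 0 then mat 1 else f (1 / w))"

definition Lambda_minus :: "real \<Rightarrow> (complex^3^3) set \<Rightarrow> (complex \<Rightarrow> complex^3^3) set" where
  "Lambda_minus r G = {f.
     (\<forall>i j. (\<lambda>z. f z $ i $ j) holomorphic_on {z. norm z < r}) \<and>
     (\<forall>i j. (\<lambda>w. infinity_chart f w $ i $ j) holomorphic_on {w. norm w < r}) \<and>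
     (\<forall>z\<in>loop_domain r. f z \<in> G)}"

text \<open>The radius may depend on the element. At infinity both symmetry conditions hold
  automatically, as sigma and tau fix the identity.\<close>

definition Lambda_minus_tau_sigma :: "(complex^3^3) set \<Rightarrow> (complex \<Rightarrow> complex^3^3) set" where
  "Lambda_minus_tau_sigma G = {f. \<exists>r. 0 < r \<and> r < 1 \<and> f \<in> Lambda_minus r G \<and>
     (\<forall>z\<in>loop_domain r. tau (f (cnj z)) = f z \<and> sigma (f z) = f (eps * z))}"

text \<open>The representation is in lowest terms, so that the roots of the denominator are exactly the
  poles and the values of the function are prescribed at every other point.\<close>

definition rational_matrix :: "(complex \<Rightarrow> complex^3^3) \<Rightarrow> bool" where
  "rational_matrix f \<longleftrightarrow> (\<exists>(N :: complex poly^3^3) (q :: complex poly). q \<noteq> 0 \<and>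
     (\<forall>z. poly q z = 0 \<longrightarrow> (\<exists>i j. poly (N $ i $ j) z \<noteq> 0)) \<and>
     (\<forall>z. poly q z \<noteq> 0 \<longrightarrow> (\<forall>i j. f z $ i $ j = poly (N $ i $ j) z / poly q z)))"

definition matrix_pole :: "(complex \<Rightarrow> complex^3^3) \<Rightarrow> complex \<Rightarrow> bool" where
  "matrix_pole f z \<longleftrightarrow> (\<exists>i j. is_pole (\<lambda>w. f w $ i $ j) z)"

definition matrix_simple_pole :: "(complex \<Rightarrow> complex^3^3) \<Rightarrow> complex \<Rightarrow> bool" where
  "matrix_simple_pole f z \<longleftrightarrow> matrix_pole f z \<and>
     (\<forall>i j. is_pole (\<lambda>w. f w $ i $ j) z \<longrightarrow> zorder (\<lambda>w. f w $ i $ j) z = -1)"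

definition simplest_rational_element :: "(complex \<Rightarrow> complex^3^3) \<Rightarrow> bool" where
  "simplest_rational_element g \<longleftrightarrow>
     g \<in> Lambda_minus_tau_sigma GL3 \<and> rational_matrix g \<and>
     (\<exists>\<beta>. \<beta> \<noteq> 0 \<and>
        {z. matrix_pole g z} = {\<beta>, eps^2 * \<beta>, eps^4 * \<beta>} \<and>
        (\<forall>z\<in>{\<beta>, eps^2 * \<beta>, eps^4 * \<beta>}. matrix_simple_pole g z) \<and>
        \<not> (\<forall>z. z^3 \<noteq> \<beta>^3 \<longrightarrow> g z = mat ((z^3 + \<beta>^3) / (z^3 - \<beta>^3))))"

definition Delta :: "(complex^3) set" where
  "Delta = {z. 2 * z $ 1 * z $ 2 = (z $ 3)^2 \<or> z $ 3 = 0}"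

definition Delta0 :: "(real^3) set" where
  "Delta0 = {v. (\<chi> i. complex_of_real (v $ i)) \<in> Delta}"

definition real_line :: "real \<Rightarrow> real \<Rightarrow> (real^3) set" where
  "real_line a b = {t *\<^sub>R vector [a, b, 1] | t. True}"

lemma real_line_not_subset_Delta0_iff: "\<not> real_line a b \<subseteq> Delta0 \<longleftrightarrow> 2 * a * b \<noteq> 1"
proof -
  have mem: "t *\<^sub>R vector [a, b, 1] \<in> Delta0 \<longleftrightarrow> 2 * (t * a) * (t * b) = t^2 \<or> t = 0" for t
  proof -
    have "t *\<^sub>R vector [a, b, 1] \<in> Delta0 \<longleftrightarrow>
        complex_of_real (2 * (t * a) * (t * b)) = complex_of_real (t^2) \<or> t = 0"
      by (simp add: Delta0_def Delta_def)
    then show ?thesis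
      unfolding of_real_eq_iff .
  qed
  have "2 * (t * a) * (t * b) = t^2 * (2 * a * b)" for t :: real
    by (simp add: power2_eq_square)
  then have "t *\<^sub>R vector [a, b, 1] \<in> Delta0 \<longleftrightarrow> t^2 * (2 * a * b) = t^2 \<or> t = 0" for t
    by (simp only: mem)
  then have "t *\<^sub>R vector [a, b, 1] \<in> Delta0 \<longleftrightarrow> 2 * a * b = 1 \<or> t = 0" for t
    by (auto simp: mult_cancel_left1)
  then show ?thesis
    unfolding real_line_def by (auto intro: exI[of _ "1::real"])
qed

text \<open>In the next two definitions, multiplication by the scalar matrix mat c is scalar
  multiplication by c.\<close>

definition g_elem :: "real \<Rightarrow> real \<Rightarrow> real \<Rightarrow> complex \<Rightarrow> complex^3^3" where
  "g_elem \<alpha> a b z = mat 1 + mat (2 / (z^3 - \<alpha>^3)) ** vector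
     [vector [\<alpha>^3 * a * b / (2*a*b - 1), \<alpha> * z^2 * b^2 / (2*a*b - 1), \<alpha>^2 * z * b / (2*a*b - 1)],
      vector [\<alpha>^2 * z * a^2, \<alpha>^3 * a * b, \<alpha> * z^2 * a],
      vector [\<alpha> * z^2 * a, \<alpha>^2 * z * b, \<alpha>^3]]"

definition h_elem :: "real \<Rightarrow> real \<Rightarrow> real \<Rightarrow> complex \<Rightarrow> complex^3^3" where
  "h_elem \<alpha> a b z = mat 1 + mat (2 / (z^3 - \<alpha>^3)) ** vector
     [vector [\<alpha>^3 * (a*b - 1) / (2*a*b - 1), - \<alpha> * z^2 * b^2 / (2*a*b - 1), \<alpha>^2 * z * b / (2*a*b - 1)],
      vector [\<alpha>^2 * z * a^2, \<alpha>^3 * (1 - a*b), - \<alpha> * z^2 * a],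
      vector [- \<alpha> * z^2 * a, \<alpha>^2 * z * b, 0]]"

end

theory Submission
  imports Defs "HOL-Computational_Algebra.Fundamental_Theorem_Algebra"
begin

text \<open>Simple poles together with the value at infinity force \<open>g = I + R(z) / (z^3 - B)\<close> with
  \<open>B = \<beta>^3\<close> and the entries of \<open>R\<close> quadratic in \<open>z\<close>. The second iterate of the twisting condition
  leaves a single monomial in each entry of \<open>R\<close>, hence nine coefficients, and the reality condition
  makes these and \<open>B\<close> real. The third iterate, the orthogonality relation
  \<open>g(- z)\<^sup>t P g(z) = P\<close>, becomes a system of quadratic equations for the coefficients. The (3,3)
  coefficient \<open>x\<close> satisfies \<open>x (x - 2 B) = 0\<close>: \<open>x = 2 B\<close> gives rank 1 type or the scalar element, and
  \<open>x = 0\<close> gives rank 2 type or the identity.\<close>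

no_notation fps_nth (infixl "$" 75)

section \<open>Poles and the value at infinity\<close>

lemma poly_neq_0_at_infinity:
  fixes p :: "complex poly"
  assumes "p \<noteq> 0"
  shows "\<forall>\<^sub>F z in at_infinity. poly p z \<noteq> 0"
proof -
  have "bounded {z. poly p z = 0}"
    using poly_roots_finite[OF assms] by (rule finite_imp_bounded)
  then obtain B where "\<And>z. poly p z = 0 \<Longrightarrow> norm z \<le> B"
    by (auto simp: bounded_iff)
  then show ?thesis
    by (intro eventually_at_infinityI[of "B + 1"]) fastforce
qed

text \<open>The remainder also has a quotient tending to 0, so the polynomial \<open>p div q\<close>
  tends to 0 at infinity, which only the zero polynomial does. This bounds the degrees of the
  numerators of \<open>g - I\<close>.\<close>

lemma mod_eq_self_if_quotient_tendsto_0: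
  fixes p q :: "complex poly"
  assumes "((\<lambda>z. poly p z / poly q z) \<longlongrightarrow> 0) at_infinity" and "q \<noteq> 0"
  shows "p mod q = p"
proof -
  have r: "((\<lambda>z. poly (p mod q) z / poly q z) \<longlongrightarrow> 0) at_infinity"
  proof (cases "p mod q = 0")
    case False
    then have "degree (p mod q) < degree q"
      using degree_mod_less[OF \<open>q \<noteq> 0\<close>, of p] by auto
    then show ?thesis
      by (rule poly_divide_tendsto_0_at_infinity)
  qed simp
  have "((\<lambda>z. poly p z / poly q z - poly (p mod q) z / poly q z) \<longlongrightarrow> 0 - 0) at_infinity"
    by (intro tendsto_diff assms r)
  moreover have "\<forall>\<^sub>F z in at_infinity.
      poly p z / poly q z - poly (p mod q) z / poly q z = poly (p div q) z"
    using poly_neq_0_at_infinity[OF \<open>q \<noteq> 0\<close>]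
  proof eventually_elim
    case (elim z)
    have "poly p z = poly (p div q) z * poly q z + poly (p mod q) z"
      by (metis div_mult_mod_eq poly_add poly_mult)
    then show ?case
      using elim by (simp add: field_simps)
  qed
  ultimately have d: "(poly (p div q) \<longlongrightarrow> 0) at_infinity"
    by (simp add: tendsto_cong)
  have "degree (p div q) = 0"
  proof (rule ccontr)
    assume "degree (p div q) \<noteq> 0"
    then have "filterlim (poly (p div q)) at_infinity at_infinity"
      by (intro filterlim_poly_at_infinity) auto
    with d show False
      using not_tendsto_and_filterlim_at_infinity[OF _ d] trivial_limit_at_infinity by blast
  qed
  then obtain k where "p div q = [:k:]"
    by (meson degree_eq_zeroE)
  moreover have "poly [:k:] = (\<lambda>_. k)"
    by auto
  ultimately have "p div q = 0"
    using d by (simp add: tendsto_const_iff[OF trivial_limit_at_infinity])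
  then show ?thesis
    by (metis add.left_neutral div_mult_mod_eq mult_zero_left)
qed

text \<open>Splitting off the full power of \<open>w - z\<close> from \<open>q\<close> leaves a
  cofactor \<open>s\<close> that is nonzero at \<open>z\<close>; so \<open>n / s\<close> is
  holomorphic and nonzero there, and the pole order is the multiplicity of the root.\<close>

lemma is_pole_poly_quotient:
  fixes n q :: "complex poly"
  assumes ev: "\<forall>\<^sub>F w in at z. f w = poly n w / poly q w"
    and "poly q z = 0" "poly n z \<noteq> 0" "q \<noteq> 0"
  shows "is_pole f z" and "zorder f z = - int (order z q)"
proof -
  obtain s where s: "q = [:- z, 1:] ^ order z q * s" "\<not> [:- z, 1:] dvd s"
    using order_decomp[OF \<open>q \<noteq> 0\<close>] by blast
  then have sz: "poly s z \<noteq> 0"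
    by (simp add: poly_eq_0_iff_dvd)
  have pos: "order z q > 0"
    using assms by (simp add: order_gt_0_iff)
  define S where "S = - {w. poly s w = 0}"
  have S: "open S" "z \<in> S"
    using sz by (auto simp: S_def intro!: closed_Collect_eq continuous_intros)
  have hol: "(\<lambda>w. poly n w / poly s w) holomorphic_on S"
    by (auto simp: S_def intro!: holomorphic_intros)
  have qs: "poly q w = (w - z) ^ order z q * poly s w" for w
    by (subst s(1)) simp
  have "is_pole (\<lambda>w. (poly n w / poly s w) / (w - z) ^ order z q) z"
    by (rule is_pole_basic[OF hol S]) (use pos sz assms in auto)
  moreover have "poly n w / poly s w / (w - z) ^ order z q = poly n w / poly q w" for w
    unfolding qs by (simp add: mult.commute)
  ultimately have "is_pole (\<lambda>w. poly n w / poly q w) z"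
    by (simp only:)
  then show "is_pole f z"
    using is_pole_cong[OF ev refl] by blast
  have "zorder f z = zorder (\<lambda>w. poly n w / poly q w) z"
    by (rule zorder_cong[OF ev refl])
  also have "\<dots> = - int (order z q)"
    by (rule zorder_eqI[OF S hol])
       (use sz assms in \<open>simp_all add: qs power_int_minus divide_inverse mult_ac\<close>)
  finally show "zorder f z = - int (order z q)" .
qed

text \<open>A disc is uncountable, the roots of a nonzero polynomial are finitely many. Symmetries
  known only near 0 thereby become identities between coefficients.\<close>

lemma poly_eq_0_if_vanishes_near_0:
  fixes p :: "complex poly"
  assumes "\<And>z. norm z < \<delta> \<Longrightarrow> poly p z = 0" and "\<delta> > 0"
  shows "p = 0"
proof (rule ccontr)
  assume "p \<noteq> 0"
  moreover have "ball 0 \<delta> \<subseteq> {z. poly p z = 0}"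
    using assms by auto
  ultimately have "finite (ball 0 \<delta> :: complex set)"
    using poly_roots_finite finite_subset by blast
  then show False
    using \<open>\<delta> > 0\<close> uncountable_ball countable_finite by blast
qed

section \<open>Arithmetic of the sixth root of unity\<close>

lemma eps_power: "eps ^ 3 = - 1" "eps ^ 2 = eps - 1" "eps \<noteq> 0"
proof -
  have e: "eps = Complex (1/2) (sqrt 3 / 2)"
    by (simp add: eps_def exp_eq_polar cis_def cos_60 sin_60 complex_eq_iff)
  show "eps ^ 3 = - 1" "eps ^ 2 = eps - 1" "eps \<noteq> 0"
    by (simp_all add: e complex_eq_iff power2_eq_square power3_eq_cube)
qed

text \<open>\<open>eps^2\<close> is a primitive cube root of unity. Distinctness separates the three
  poles and later kills the coefficients excluded by the twisting.\<close>

lemma eps_distinct: "eps^2 \<noteq> 1" "eps^4 \<noteq> 1" "eps^4 \<noteq> eps^2"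
proof -
  have e4: "eps^4 = - eps"
    using eps_power(1) by (simp add: numeral_eq_Suc)
  show e2: "eps^2 \<noteq> 1"
  proof
    assume "eps^2 = 1"
    then have "(3::complex) = 0"
      using eps_power(2) by algebra
    then show False
      by simp
  qed
  show "eps^4 \<noteq> 1"
  proof
    assume "eps^4 = 1"
    then have "eps = - 1"
      using e4 by (metis minus_minus)
    then have "eps^2 = 1"
      by (metis one_power2 power2_minus)
    with e2 show False
      by contradiction
  qed
  show "eps^4 \<noteq> eps^2"
  proof
    assume "eps^4 = eps^2"
    then have "eps^2 * eps^2 = eps^2 * 1"
      by (simp flip: power_add)
    then have "eps^2 = 1"
      using eps_power(3) by (subst (asm) mult_left_cancel) auto
    with e2 show False
      by contradiction
  qed
qed

lemma poly_degree_less_3: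
  fixes p :: "'a::comm_semiring_1 poly"
  assumes "degree p < 3"
  shows "poly p z = coeff p 0 + coeff p 1 * z + coeff p 2 * z\<^sup>2"
proof -
  have "p = [:coeff p 0, coeff p 1, coeff p 2:]"
    using assms
    by (intro poly_eqI) (auto simp: coeff_pCons coeff_eq_0 numeral_2_eq_2 split: nat.splits)
  then have "poly p z = poly [:coeff p 0, coeff p 1, coeff p 2:] z"
    by simp
  also have "\<dots> = coeff p 0 + coeff p 1 * z + coeff p 2 * z\<^sup>2"
    by (simp add: algebra_simps power2_eq_square)
  finally show ?thesis .
qed

section \<open>Denominator and numerator of a simplest element\<close>

text \<open>In lowest terms some entry of \<open>N\<close> is nonzero at each root of
  \<open>q\<close>, so nothing cancels and that entry has the full multiplicity of the root as its
  pole order.\<close>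

lemma roots_of_denominator:
  fixes N :: "complex poly^3^3" and q :: "complex poly" and g :: "complex \<Rightarrow> complex^3^3"
  assumes q: "q \<noteq> 0" "\<And>z. poly q z = 0 \<Longrightarrow> \<exists>i j. poly (N $ i $ j) z \<noteq> 0"
    and g: "\<And>z i j. poly q z \<noteq> 0 \<Longrightarrow> g z $ i $ j = poly (N $ i $ j) z / poly q z"
  shows "poly q z = 0 \<longleftrightarrow> matrix_pole g z"
    and "matrix_simple_pole g z \<Longrightarrow> order z q = 1"
proof -
  have ev: "\<forall>\<^sub>F w in at z. g w $ i $ j = poly (N $ i $ j) w / poly q w" for i j
  proof -
    \<comment> \<open>The other roots stay away from \<open>z\<close>; \<open>z\<close> itself may
      be a root, since \<open>at z\<close> ignores it.\<close>
    have "finite ({w. poly q w = 0} - {z})"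
      using poly_roots_finite[OF q(1)] by blast
    then have "open (- ({w. poly q w = 0} - {z}))"
      by (intro open_Compl finite_imp_closed)
    then have "\<forall>\<^sub>F w in at z. w \<in> - ({w. poly q w = 0} - {z}) - {z}"
      by (rule eventually_at_in_open) auto
    then show ?thesis
      by eventually_elim (use g in auto)
  qed
  show "poly q z = 0 \<longleftrightarrow> matrix_pole g z"
  proof
    assume "poly q z = 0"
    then show "matrix_pole g z"
      using q is_pole_poly_quotient(1)[OF ev] unfolding matrix_pole_def by blast
  next
    assume "matrix_pole g z"
    then obtain i j where "is_pole (\<lambda>w. g w $ i $ j) z"
      unfolding matrix_pole_def by blast
    then have "is_pole (\<lambda>w. poly (N $ i $ j) w / poly q w) z"
      using is_pole_cong[OF ev refl] by blast
    moreover have "(\<lambda>w. poly (N $ i $ j) w / poly q w) holomorphic_on {w. poly q w \<noteq> 0}"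
      by (intro holomorphic_intros) auto
    moreover have "open {w. poly q w \<noteq> 0}"
      by (intro open_Collect_neq continuous_intros)
    ultimately show "poly q z = 0"
      using not_is_pole_holomorphic by blast
  qed
  then show "order z q = 1" if "matrix_simple_pole g z"
  proof -
    have z: "poly q z = 0"
      using \<open>poly q z = 0 \<longleftrightarrow> matrix_pole g z\<close> that by (simp add: matrix_simple_pole_def)
    then obtain i j where ij: "poly (N $ i $ j) z \<noteq> 0"
      using q by blast
    show ?thesis
      using is_pole_poly_quotient[OF ev z ij q(1)] that
      unfolding matrix_simple_pole_def by fastforce
  qed
qed

lemma cube_root_factorization:
  "(z - \<beta>) * (z - eps^2 * \<beta>) * (z - eps^4 * \<beta>) = z^3 - \<beta>^3"
proof -
  have e: "eps^4 = - eps"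
    using eps_power(1) by (simp add: numeral_eq_Suc)
  show ?thesis
    unfolding e using eps_power(2) by algebra
qed

text \<open>In the chart \<open>w = 1 / z\<close> the map is continuous at \<open>w = 0\<close> with
  value \<open>I\<close>; composing with \<open>inverse\<close> carries this limit to
  infinity.\<close>

lemma Lambda_minus_tendsto_infinity:
  fixes f :: "complex \<Rightarrow> complex^3^3"
  assumes "f \<in> Lambda_minus r G" "r > 0"
  shows "((\<lambda>z. f z $ i $ j) \<longlongrightarrow> mat 1 $ i $ j) at_infinity"
proof -
  have "(\<lambda>w. infinity_chart f w $ i $ j) holomorphic_on ball 0 r"
    using assms by (simp add: Lambda_minus_def ball_def)
  then have "isCont (\<lambda>w. infinity_chart f w $ i $ j) 0"
    using \<open>r > 0\<close> holomorphic_on_imp_continuous_on continuous_on_interior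
    by (metis centre_in_ball interior_ball)
  then have "((\<lambda>w. infinity_chart f w $ i $ j) \<longlongrightarrow> infinity_chart f 0 $ i $ j) (nhds 0)"
    by (simp add: continuous_at_imp_continuous_at_within isCont_def tendsto_nhds_iff)
  then have "((\<lambda>z. infinity_chart f (inverse z) $ i $ j) \<longlongrightarrow> infinity_chart f 0 $ i $ j) at_infinity"
    by (rule filterlim_compose) (rule tendsto_inverse_0)
  moreover have "\<forall>\<^sub>F z in at_infinity. infinity_chart f (inverse z) $ i $ j = f z $ i $ j"
    using eventually_not_equal_at_infinity[of 0]
    by eventually_elim (simp add: infinity_chart_def divide_inverse)
  ultimately show ?thesis
    by (simp add: tendsto_cong infinity_chart_def)
qed

text \<open>The denominator is cleared so that every later condition becomes polynomial in
  \<open>z\<close>. The symmetries are kept only on a disc around 0, where coefficients will be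
  compared.\<close>

lemma simplest_rational_element_form:
  fixes g :: "complex \<Rightarrow> complex^3^3"
  assumes "simplest_rational_element g"
  obtains B \<delta> and A0 A1 A2 :: "complex^3^3" where "B \<noteq> 0" "\<delta> > 0"
    "\<And>z i j. z^3 \<noteq> B \<Longrightarrow> g z $ i $ j * (z^3 - B) =
       mat (z^3 - B) $ i $ j + (A0 $ i $ j + A1 $ i $ j * z + A2 $ i $ j * z\<^sup>2)"
    "A0 \<noteq> 0 \<or> A1 \<noteq> 0 \<or> A2 \<noteq> 0"
    "\<And>z. norm z < \<delta> \<Longrightarrow> z^3 \<noteq> B"
    "\<And>z. norm z < \<delta> \<Longrightarrow> invertible (g z)"
    "\<And>z. norm z < \<delta> \<Longrightarrow> tau (g (cnj z)) = g z"
    "\<And>z. norm z < \<delta> \<Longrightarrow> sigma (g z) = g (eps * z)"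
    "\<not> (\<forall>z. z^3 \<noteq> B \<longrightarrow> g z = mat ((z^3 + B) / (z^3 - B)))"
proof -
  from assms obtain \<beta> r and N :: "complex poly^3^3" and q :: "complex poly" where
    \<beta>: "\<beta> \<noteq> 0" "{z. matrix_pole g z} = {\<beta>, eps^2 * \<beta>, eps^4 * \<beta>}"
      "\<And>z. z \<in> {\<beta>, eps^2 * \<beta>, eps^4 * \<beta>} \<Longrightarrow> matrix_simple_pole g z"
      "\<not> (\<forall>z. z^3 \<noteq> \<beta>^3 \<longrightarrow> g z = mat ((z^3 + \<beta>^3) / (z^3 - \<beta>^3)))"
    and q: "q \<noteq> 0" "\<And>z. poly q z = 0 \<Longrightarrow> \<exists>i j. poly (N $ i $ j) z \<noteq> 0"
    and g: "\<And>z i j. poly q z \<noteq> 0 \<Longrightarrow> g z $ i $ j = poly (N $ i $ j) z / poly q z"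
    and r: "0 < r" "g \<in> Lambda_minus r GL3"
      "\<And>z. z \<in> loop_domain r \<Longrightarrow> tau (g (cnj z)) = g z \<and> sigma (g z) = g (eps * z)"
    unfolding simplest_rational_element_def Lambda_minus_tau_sigma_def rational_matrix_def
    by blast
  note roots = roots_of_denominator[of q N g, OF q g]
  have roots_q: "{z. poly q z = 0} = {\<beta>, eps^2 * \<beta>, eps^4 * \<beta>}"
    using \<beta>(2) roots(1) by simp
  define c where "c = lead_coeff q"
  have c: "c \<noteq> 0"
    using q by (simp add: c_def)
  have distinct: "\<beta> \<noteq> eps\<^sup>2 * \<beta>" "\<beta> \<noteq> eps ^ 4 * \<beta>" "eps ^ 2 * \<beta> \<noteq> eps ^ 4 * \<beta>"
    using \<beta>(1) eps_distinct by auto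
  have "q = smult c (\<Prod>z\<in>{\<beta>, eps^2 * \<beta>, eps^4 * \<beta>}. [:-z, 1:] ^ order z q)"
    unfolding c_def roots_q[symmetric] by (rule complex_poly_decompose[symmetric])
  \<comment> \<open>Simplicity of the poles turns every exponent into 1.\<close>
  also have "(\<Prod>z\<in>{\<beta>, eps^2 * \<beta>, eps^4 * \<beta>}. [:-z, 1:] ^ order z q)
      = (\<Prod>z\<in>{\<beta>, eps^2 * \<beta>, eps^4 * \<beta>}. [:-z, 1:])"
    by (intro prod.cong refl) (simp add: roots(2) \<beta>(3))
  finally have q_eq: "q = smult c ([:-\<beta>, 1:] * [:-(eps^2 * \<beta>), 1:] * [:-(eps^4 * \<beta>), 1:])"
    using distinct by (simp add: algebra_simps)
  have poly_q: "poly q z = c * (z^3 - \<beta>^3)" for z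
    unfolding cube_root_factorization[symmetric] by (subst q_eq) (simp add: algebra_simps)
  have deg_q: "degree q = 3"
    by (subst q_eq) (simp add: c degree_mult_eq)
  \<comment> \<open>\<open>R\<close> is the numerator of \<open>g - I\<close> over the denominator
    \<open>q\<close>.\<close>
  define R where "R i j = N $ i $ j - (if i = j then q else 0)" for i j
  have R: "poly (R i j) z = (g z $ i $ j - mat 1 $ i $ j) * poly q z" if "poly q z \<noteq> 0" for i j z
    using g[OF that] that by (simp add: R_def mat_def field_simps)
  have deg_R: "degree (R i j) < 3" for i j
  proof -
    have "((\<lambda>z. g z $ i $ j - mat 1 $ i $ j) \<longlongrightarrow> 0) at_infinity"
      using Lambda_minus_tendsto_infinity[OF r(2,1)] LIM_zero by blast
    moreover have "\<forall>\<^sub>F z in at_infinity. g z $ i $ j - mat 1 $ i $ j = poly (R i j) z / poly q z"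
      using poly_neq_0_at_infinity[OF q(1)] by eventually_elim (simp add: R)
    ultimately have "((\<lambda>z. poly (R i j) z / poly q z) \<longlongrightarrow> 0) at_infinity"
      by (simp add: tendsto_cong)
    then have "R i j mod q = R i j"
      using q(1) by (rule mod_eq_self_if_quotient_tendsto_0)
    then show ?thesis
      using degree_mod_less[OF q(1), of "R i j"] deg_q by auto
  qed
  define A where "A k = (\<chi> i j. coeff (R i j) k / c)" for k
  show ?thesis
  \<comment> \<open>Below \<open>r\<close> a point lies in the loop domain; below
    \<open>norm \<beta>\<close> its cube differs from \<open>\<beta>^3\<close>.\<close>
  proof (rule that[of "\<beta>^3" "min r (norm \<beta>)" "A 0" "A 1" "A 2"])
    show "g z $ i $ j * (z^3 - \<beta>^3) = mat (z^3 - \<beta>^3) $ i $ j +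
        (A 0 $ i $ j + A 1 $ i $ j * z + A 2 $ i $ j * z\<^sup>2)" if "z^3 \<noteq> \<beta>^3" for z i j
    proof -
      have "poly (R i j) z / c = A 0 $ i $ j + A 1 $ i $ j * z + A 2 $ i $ j * z\<^sup>2"
        by (simp add: poly_degree_less_3[OF deg_R] A_def add_divide_distrib)
      moreover have "poly (R i j) z / c = (g z $ i $ j - mat 1 $ i $ j) * (z^3 - \<beta>^3)"
        using R[of z i j] c that by (simp add: poly_q)
      ultimately show ?thesis
        by (cases "i = j") (simp_all add: mat_def algebra_simps)
    qed
    show "A 0 \<noteq> 0 \<or> A 1 \<noteq> 0 \<or> A 2 \<noteq> 0"
    proof (rule ccontr)
      \<comment> \<open>A vanishing \<open>R\<close> would make \<open>N\<close> equal to
        \<open>q\<close> times the identity, hence zero at \<open>\<beta>\<close>, against lowest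
        terms.\<close>
      assume "\<not> ?thesis"
      then have "coeff (R i j) k = 0" if "k < 3" for i j k
        using that c by (auto simp: A_def vec_eq_iff less_Suc_eq numeral_eq_Suc)
      then have R0: "poly (R i j) \<beta> = 0" for i j
        by (simp add: poly_degree_less_3[OF deg_R])
      have "poly q \<beta> = 0"
        by (simp add: poly_q)
      moreover obtain i j where "poly (N $ i $ j) \<beta> \<noteq> 0"
        using q(2)[OF \<open>poly q \<beta> = 0\<close>] by blast
      ultimately show False
        using R0[of i j] by (auto simp: R_def split: if_splits)
    qed
    show "z^3 \<noteq> \<beta>^3" if "norm z < min r (norm \<beta>)" for z
    proof -
      have "norm z ^ 3 < norm \<beta> ^ 3"
        using that by (intro power_strict_mono) auto
      then show ?thesis
        by (metis less_irrefl norm_power)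
    qed
    have "z \<in> loop_domain r" if "norm z < min r (norm \<beta>)" for z
      using that by (simp add: loop_domain_def)
    then show "invertible (g z)" "tau (g (cnj z)) = g z" "sigma (g z) = g (eps * z)"
      if "norm z < min r (norm \<beta>)" for z
      using that r(2,3) by (auto simp: Lambda_minus_def GL3_def)
  qed (use \<beta> r in auto)
qed

section \<open>Iterates of the twisting involution\<close>

lemma T_mat_components:
  "T_mat $ 1 $ 1 = 0" "T_mat $ 1 $ 2 = 1" "T_mat $ 1 $ 3 = 0"
  "T_mat $ 2 $ 1 = - eps" "T_mat $ 2 $ 2 = 0" "T_mat $ 2 $ 3 = 0"
  "T_mat $ 3 $ 1 = 0" "T_mat $ 3 $ 2 = 0" "T_mat $ 3 $ 3 = eps^2"
  by (simp_all add: T_mat_def)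

text \<open>The inverse of the matrix \<open>Q\<close> of the paper, because it belongs to \<open>eps^2\<close> instead of \<open>eps^4\<close>.\<close>

definition D_mat :: "complex^3^3" where
  "D_mat = vector [vector [eps^2, 0, 0], vector [0, eps^4, 0], vector [0, 0, 1]]"

definition P_mat :: "complex^3^3" where
  "P_mat = vector [vector [0, 1, 0], vector [1, 0, 0], vector [0, 0, 1]]"

lemma matrix_mult_3: "(X ** Y) $ i $ j = X$i$1 * Y$1$j + X$i$2 * Y$2$j + X$i$3 * Y$3$j"
  for X Y :: "'a::semiring_1^3^3"
  by (simp add: matrix_matrix_mult_def sum_3)

text \<open>The first relation says that \<open>D_mat\<close> is \<open>T_mat\<close> times the
  inverse of its transpose, the matrix by which \<open>sigma\<close> applied twice
  conjugates.\<close>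

lemma D_T_relations:
  "D_mat ** transpose T_mat = T_mat" "D_mat ** T_mat = mat (eps^2) ** P_mat"
proof -
  have "eps^4 = - eps" "eps^5 = - (eps^2)"
    using eps_power(1) by (simp_all add: numeral_eq_Suc)
  then show "D_mat ** transpose T_mat = T_mat" "D_mat ** T_mat = mat (eps^2) ** P_mat"
    using eps_power(1)
    by (simp_all add: vec_eq_iff forall_3 matrix_mult_3 D_mat_def P_mat_def mat_def
        T_mat_components transpose_def flip: power_Suc power_Suc2 power2_eq_square)
qed

lemma invertible_transpose:
  fixes A :: "'a::field^'n^'n"
  assumes "invertible A"
  shows "invertible (transpose A)"
  using assms by (simp add: invertible_det_nz)

lemma invertible_T_mat: "invertible T_mat"
  by (simp add: invertible_det_nz det_3 T_mat_components eps_power(3))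

lemma P_mat_square: "P_mat ** P_mat = mat 1"
  by (simp add: vec_eq_iff forall_3 matrix_mult_3 P_mat_def mat_def)

lemma transpose_P_mat: "transpose P_mat = P_mat"
  by (simp add: vec_eq_iff forall_3 P_mat_def transpose_def)

lemma matrix_inv_left_right:
  assumes "invertible A"
  shows "A ** matrix_inv A = mat 1" "matrix_inv A ** A = mat 1"
  using someI_ex[OF assms[unfolded invertible_def]] by (simp_all add: matrix_inv_def)

text \<open>Clearing both inverses in \<open>sigma\<close> leaves a relation that can be transposed
  and chained.\<close>

lemma sigma_twisted:
  assumes "invertible X"
  shows "sigma X ** T_mat ** transpose X = T_mat"
proof -
  have "sigma X ** T_mat ** transpose X
      = T_mat ** (matrix_inv (transpose X) ** (matrix_inv T_mat ** T_mat) ** transpose X)"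
    by (simp add: sigma_def matrix_mul_assoc)
  also have "\<dots> = T_mat"
    using assms
    by (simp add: matrix_inv_left_right invertible_T_mat invertible_transpose)
  finally show ?thesis .
qed

text \<open>Multiplied by \<open>Y\<close> on the right, both sides become \<open>T_mat\<close>: the
  left by the twisted relation for \<open>sigma X\<close>, the right by the transposed relation for
  \<open>X\<close>. \<open>Y\<close> is invertible and cancels.\<close>

lemma sigma_sigma:
  assumes "invertible X" "invertible (sigma X)"
  shows "sigma (sigma X) ** D_mat = D_mat ** X"
proof -
  define Y where "Y = transpose T_mat ** transpose (sigma X)"
  have "X ** Y = transpose (sigma X ** T_mat ** transpose X)"
    by (simp add: Y_def matrix_transpose_mul matrix_mul_assoc)
  then have XY: "X ** Y = transpose T_mat"
    by (simp add: sigma_twisted assms)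
  have "sigma (sigma X) ** D_mat ** Y = sigma (sigma X) ** (D_mat ** transpose T_mat) ** transpose (sigma X)"
    by (simp add: Y_def matrix_mul_assoc)
  also have "\<dots> = T_mat"
    by (simp only: D_T_relations sigma_twisted[OF assms(2)])
  also have "\<dots> = D_mat ** X ** Y"
    by (simp add: D_T_relations XY flip: matrix_mul_assoc)
  finally have "sigma (sigma X) ** D_mat ** (Y ** matrix_inv Y) = D_mat ** X ** (Y ** matrix_inv Y)"
    by (simp add: matrix_mul_assoc)
  moreover have "invertible Y"
    by (simp add: Y_def invertible_mult invertible_transpose assms invertible_T_mat)
  ultimately show ?thesis
    by (simp add: matrix_inv_left_right)
qed

text \<open>The third iterate of \<open>sigma\<close> is the P-condition, because \<open>D_mat\<close> times \<open>T_mat\<close>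
  is a scalar multiple of \<open>P_mat\<close>.\<close>

lemma sigma_sigma_sigma:
  assumes "invertible X" "invertible (sigma X)" "invertible (sigma (sigma X))"
  shows "transpose (sigma (sigma (sigma X))) ** P_mat ** X = P_mat"
proof -
  define W where "W = sigma (sigma (sigma X))"
  have "W ** (D_mat ** T_mat) ** transpose X = (W ** D_mat) ** T_mat ** transpose X"
    by (simp add: matrix_mul_assoc)
  also have "\<dots> = D_mat ** (sigma X ** T_mat ** transpose X)"
    by (simp add: W_def sigma_sigma assms matrix_mul_assoc)
  also have "\<dots> = D_mat ** T_mat"
    by (simp add: sigma_twisted assms)
  finally have "mat (eps^2) ** (W ** P_mat ** transpose X) = mat (eps^2) ** P_mat"
    by (simp add: D_T_relations vec_eq_iff forall_3 matrix_mult_3 mat_def algebra_simps)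
  then have "W ** P_mat ** transpose X = P_mat"
    using eps_power(3) by (simp add: vec_eq_iff matrix_mult_3 mat_def forall_3)
  then have "(W ** P_mat ** transpose X) ** P_mat = mat 1"
    by (simp add: P_mat_square)
  \<comment> \<open>A one-sided inverse of a square matrix is two-sided, so \<open>W\<close> moves
    to the other end; transposing then yields the desired order of factors.\<close>
  then have "(P_mat ** transpose X ** P_mat) ** W = mat 1"
    by (metis matrix_left_right_inverse matrix_mul_assoc)
  then have "transpose ((P_mat ** transpose X ** P_mat) ** W) = mat 1"
    by (simp add: transpose_mat)
  then have "transpose W ** P_mat ** X ** P_mat = mat 1"
    by (simp add: matrix_transpose_mul matrix_mul_assoc transpose_P_mat)
  then have "transpose W ** P_mat ** X ** (P_mat ** P_mat) = P_mat"
    by (simp add: matrix_mul_assoc)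
  then show ?thesis
    by (simp add: P_mat_square W_def)
qed

section \<open>Coefficients of a simplest element\<close>

lemma quadratic_coeffs_eq_0:
  fixes a b c :: complex
  assumes "\<And>z. norm z < \<delta> \<Longrightarrow> a + b * z + c * z\<^sup>2 = 0" and "\<delta> > 0"
  shows "a = 0" "b = 0" "c = 0"
proof -
  have "[:a, b, c:] = 0"
    by (rule poly_eq_0_if_vanishes_near_0[OF _ \<open>\<delta> > 0\<close>])
       (use assms(1) in \<open>simp add: algebra_simps power2_eq_square\<close>)
  then show "a = 0" "b = 0" "c = 0"
    by simp_all
qed

text \<open>With \<open>\<omega> = eps^2\<close> and \<open>D_mat\<close> having the diagonal \<open>\<omega>\<close>, \<open>\<omega>^2\<close>, \<open>1\<close>, the twisting leaves
  only the power of \<open>z\<close> whose exponent is congruent modulo 3 to the difference of the exponents.\<close>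

lemma twisted_coeff_pattern:
  fixes g :: "complex \<Rightarrow> complex^3^3" and A0 A1 A2 :: "complex^3^3"
  assumes "\<delta> > 0"
    and g: "\<And>z i j. z^3 \<noteq> B \<Longrightarrow> g z $ i $ j * (z^3 - B) =
       mat (z^3 - B) $ i $ j + (A0 $ i $ j + A1 $ i $ j * z + A2 $ i $ j * z\<^sup>2)"
    and B: "\<And>z. norm z < \<delta> \<Longrightarrow> z^3 \<noteq> B"
    and D: "\<And>z. norm z < \<delta> \<Longrightarrow> g (eps^2 * z) ** D_mat = D_mat ** g z"
  shows "A0 $ 1 $ 2 = 0" "A0 $ 1 $ 3 = 0" "A0 $ 2 $ 1 = 0" "A0 $ 2 $ 3 = 0" "A0 $ 3 $ 1 = 0" "A0 $ 3 $ 2 = 0"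
    "A1 $ 1 $ 1 = 0" "A1 $ 1 $ 2 = 0" "A1 $ 2 $ 2 = 0" "A1 $ 2 $ 3 = 0" "A1 $ 3 $ 1 = 0" "A1 $ 3 $ 3 = 0"
    "A2 $ 1 $ 1 = 0" "A2 $ 1 $ 3 = 0" "A2 $ 2 $ 1 = 0" "A2 $ 2 $ 2 = 0" "A2 $ 3 $ 2 = 0" "A2 $ 3 $ 3 = 0"
proof -
  have e6: "eps ^ 6 = 1"
    using power_mult[of eps 3 2] by (simp add: eps_power(1))
  define d where "d i = D_mat $ i $ i" for i
  have d: "d 1 = eps^2" "d 2 = eps^4" "d 3 = 1"
    by (simp_all add: d_def D_mat_def)
  have coeffs: "A0 $ i $ j * (d j - d i) = 0 \<and> A1 $ i $ j * (eps^2 * d j - d i) = 0 \<and>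
      A2 $ i $ j * (eps^4 * d j - d i) = 0" for i j
  proof -
    have *: "A0 $ i $ j * (d j - d i) + A1 $ i $ j * (eps^2 * d j - d i) * z +
        A2 $ i $ j * (eps^4 * d j - d i) * z\<^sup>2 = 0" if "norm z < \<delta>" for z
    proof -
      \<comment> \<open>Since \<open>eps^6 = 1\<close>, the denominator is unchanged under rotation
        by \<open>eps^2\<close>, and numerators can be compared directly.\<close>
      have cube: "(eps^2 * z)^3 = z^3"
        by (simp add: power_mult_distrib e6 flip: power_mult)
      have "g (eps^2 * z) $ i $ j * d j = d i * g z $ i $ j"
      proof -
        have "(g (eps^2 * z) ** D_mat) $ i $ j = (D_mat ** g z) $ i $ j"
          using D[OF that] by simp
        then show ?thesis
          using exhaust_3[of i] exhaust_3[of j]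
          by (auto simp: matrix_mult_3 d_def D_mat_def)
      qed
      then have "g (eps^2 * z) $ i $ j * (z^3 - B) * d j = d i * (g z $ i $ j * (z^3 - B))"
        by simp
      note twisted = this
      have "(eps^2 * z)\<^sup>2 = eps^4 * z\<^sup>2"
        by (simp add: power_mult_distrib)
      then have "g (eps^2 * z) $ i $ j * (z^3 - B) = mat (z^3 - B) $ i $ j +
          (A0 $ i $ j + A1 $ i $ j * (eps^2 * z) + A2 $ i $ j * (eps^4 * z\<^sup>2))"
        using g[of "eps^2 * z" i j, unfolded cube, OF B[OF that]] by (simp only:)
      from twisted[unfolded this g[OF B[OF that]]]
      have "(mat (z^3 - B) $ i $ j + (A0 $ i $ j + A1 $ i $ j * (eps^2 * z) + A2 $ i $ j * (eps^4 * z\<^sup>2))) * d j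
          = d i * (mat (z^3 - B) $ i $ j + (A0 $ i $ j + A1 $ i $ j * z + A2 $ i $ j * z\<^sup>2))" .
      then show ?thesis
        by (cases "i = j") (simp_all add: mat_def algebra_simps)
    qed
    show ?thesis
      using quadratic_coeffs_eq_0[OF *] \<open>\<delta> > 0\<close> by simp
  qed
  have e8: "eps ^ 8 = eps^2"
    using e6 power_add[of eps 6 2] by simp
  \<comment> \<open>In each of the 18 listed positions the factor is a difference of two distinct
    cube roots of unity, so the coefficient vanishes.\<close>
  have ne: "eps^2 \<noteq> 1" "eps^4 \<noteq> 1" "eps^4 \<noteq> eps^2" "1 \<noteq> eps^2" "1 \<noteq> eps^4" "eps^2 \<noteq> eps^4"
    using eps_distinct by metis+
  show "A0 $ 1 $ 2 = 0" "A0 $ 1 $ 3 = 0" "A0 $ 2 $ 1 = 0" "A0 $ 2 $ 3 = 0" "A0 $ 3 $ 1 = 0" "A0 $ 3 $ 2 = 0"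
    "A1 $ 1 $ 1 = 0" "A1 $ 1 $ 2 = 0" "A1 $ 2 $ 2 = 0" "A1 $ 2 $ 3 = 0" "A1 $ 3 $ 1 = 0" "A1 $ 3 $ 3 = 0"
    "A2 $ 1 $ 1 = 0" "A2 $ 1 $ 3 = 0" "A2 $ 2 $ 1 = 0" "A2 $ 2 $ 2 = 0" "A2 $ 3 $ 2 = 0" "A2 $ 3 $ 3 = 0"
    using coeffs[of 1 1] coeffs[of 1 2] coeffs[of 1 3] coeffs[of 2 1] coeffs[of 2 2] coeffs[of 2 3]
      coeffs[of 3 1] coeffs[of 3 2] coeffs[of 3 3] ne
    by (simp_all add: d e6 e8)
qed

text \<open>Conjugation gives a second expression for \<open>g\<close>, with conjugated coefficients
  over \<open>z^3 - cnj B\<close>. Cross multiplication shows that the coefficients are real, and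
  any nonzero one then forces \<open>cnj B = B\<close>.\<close>

lemma real_coeffs:
  fixes g :: "complex \<Rightarrow> complex^3^3" and A0 A1 A2 :: "complex^3^3"
  assumes "\<delta> > 0"
    and g: "\<And>z i j. z^3 \<noteq> B \<Longrightarrow> g z $ i $ j * (z^3 - B) =
       mat (z^3 - B) $ i $ j + (A0 $ i $ j + A1 $ i $ j * z + A2 $ i $ j * z\<^sup>2)"
    and B: "\<And>z. norm z < \<delta> \<Longrightarrow> z^3 \<noteq> B"
    and tau: "\<And>z. norm z < \<delta> \<Longrightarrow> tau (g (cnj z)) = g z"
    and nonzero: "A0 \<noteq> 0 \<or> A1 \<noteq> 0 \<or> A2 \<noteq> 0"
  shows "A0 $ i $ j \<in> \<real>" "A1 $ i $ j \<in> \<real>" "A2 $ i $ j \<in> \<real>" "B \<in> \<real>"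
proof -
  have coeffs: "cnj (A0 $ i $ j) = A0 $ i $ j \<and> cnj (A1 $ i $ j) = A1 $ i $ j \<and>
      cnj (A2 $ i $ j) = A2 $ i $ j \<and> A0 $ i $ j * cnj B = cnj (A0 $ i $ j) * B \<and>
      A1 $ i $ j * cnj B = cnj (A1 $ i $ j) * B \<and> A2 $ i $ j * cnj B = cnj (A2 $ i $ j) * B" for i j
  proof -
    let ?a0 = "A0 $ i $ j" and ?a1 = "A1 $ i $ j" and ?a2 = "A2 $ i $ j"
    \<comment> \<open>This is the difference of the cross products: degrees 3 to 5 express reality
      of the coefficients, degrees 0 to 2 relate \<open>B\<close> to \<open>cnj B\<close>.\<close>
    let ?p = "[:?a0 * cnj B - cnj ?a0 * B, ?a1 * cnj B - cnj ?a1 * B, ?a2 * cnj B - cnj ?a2 * B,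
        cnj ?a0 - ?a0, cnj ?a1 - ?a1, cnj ?a2 - ?a2:]"
    have "?p = 0"
    proof (rule poly_eq_0_if_vanishes_near_0[OF _ \<open>\<delta> > 0\<close>])
      fix z :: complex
      assume z: "norm z < \<delta>"
      have "cnj (g (cnj z) $ i $ j * (cnj z ^ 3 - B)) = g z $ i $ j * (z^3 - cnj B)"
        using tau[OF z] by (simp add: tau_def map_matrix_def vec_eq_iff)
      moreover have "norm (cnj z) < \<delta>"
        using z by simp
      ultimately have "g z $ i $ j * (z^3 - cnj B) = cnj (mat (cnj z ^ 3 - B) $ i $ j +
          (?a0 + ?a1 * cnj z + ?a2 * (cnj z)\<^sup>2))"
        using g[OF B] by metis
      then have 1: "g z $ i $ j * (z^3 - cnj B) = mat (z^3 - cnj B) $ i $ j +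
          (cnj ?a0 + cnj ?a1 * z + cnj ?a2 * z\<^sup>2)"
        by (cases "i = j") (simp_all add: mat_def)
      have 2: "g z $ i $ j * (z^3 - B) = mat (z^3 - B) $ i $ j + (?a0 + ?a1 * z + ?a2 * z\<^sup>2)"
        by (rule g[OF B[OF z]])
      have "mat (z^3 - B) $ i $ j * (z^3 - cnj B) = mat (z^3 - cnj B) $ i $ j * (z^3 - B)"
        by (simp add: mat_def)
      with 1 2 have "(cnj ?a0 + cnj ?a1 * z + cnj ?a2 * z\<^sup>2) * (z^3 - B)
          = (?a0 + ?a1 * z + ?a2 * z\<^sup>2) * (z^3 - cnj B)"
        by algebra
      then show "poly ?p z = 0"
        by (simp add: algebra_simps power2_eq_square power3_eq_cube)
    qed
    then show ?thesis
      by simp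
  qed
  then show "A0 $ i $ j \<in> \<real>" "A1 $ i $ j \<in> \<real>" "A2 $ i $ j \<in> \<real>"
    by (simp_all add: Reals_cnj_iff)
  from nonzero obtain i j where "A0 $ i $ j \<noteq> 0 \<or> A1 $ i $ j \<noteq> 0 \<or> A2 $ i $ j \<noteq> 0"
    by (auto simp: vec_eq_iff)
  then show "B \<in> \<real>"
    using coeffs[of i j] by (auto simp: Reals_cnj_iff)
qed

text \<open>The equations are the coefficients of the entries (1,1), (1,2), (1,3), (2,2), (2,3), (3,3) of
  \<open>P = g(- z)\<^sup>t P g(z)\<close>, multiplied by the two denominators.\<close>

lemma P_condition_equations:
  fixes g :: "complex \<Rightarrow> complex^3^3"
  assumes "\<delta> > 0"
    and P: "\<And>z. norm z < \<delta> \<Longrightarrow> transpose (g (- z)) ** P_mat ** g z = P_mat"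
    and B: "\<And>z. norm z < \<delta> \<Longrightarrow> z^3 \<noteq> B"
    and g: "\<And>z i j. z^3 \<noteq> B \<Longrightarrow> g z $ i $ j * (z^3 - B) = (vector [
      vector [z^3 - B + p, q * z\<^sup>2, r * z],
      vector [s * z, z^3 - B + t, u * z\<^sup>2],
      vector [v * z\<^sup>2, w * z, z^3 - B + x]] :: complex^3^3) $ i $ j"
  shows "v\<^sup>2 = 2 * s" "p * t = B * (p + t)" "p - t - s * q + v * w = 0"
    "u = v" "p * u + v * x = B * (u + v) + s * r" "2 * q * (t - B) = w\<^sup>2"
    "r + w = q * u" "B * (w - r) + t * r = w * x" "x * (x - 2 * B) = 0"
proof -
  have P_components: "P_mat $ 1 $ 1 = 0" "P_mat $ 1 $ 2 = 1" "P_mat $ 1 $ 3 = 0"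
    "P_mat $ 2 $ 1 = 1" "P_mat $ 2 $ 2 = 0" "P_mat $ 2 $ 3 = 0"
    "P_mat $ 3 $ 1 = 0" "P_mat $ 3 $ 2 = 0" "P_mat $ 3 $ 3 = 1"
    by (simp_all add: P_mat_def)
  define M where "M z = (vector [
      vector [z^3 - B + p, q * z\<^sup>2, r * z],
      vector [s * z, z^3 - B + t, u * z\<^sup>2],
      vector [v * z\<^sup>2, w * z, z^3 - B + x]] :: complex^3^3)" for z
  have M_components: "M z $ 1 $ 1 = z^3 - B + p" "M z $ 1 $ 2 = q * z\<^sup>2" "M z $ 1 $ 3 = r * z"
    "M z $ 2 $ 1 = s * z" "M z $ 2 $ 2 = z^3 - B + t" "M z $ 2 $ 3 = u * z\<^sup>2"
    "M z $ 3 $ 1 = v * z\<^sup>2" "M z $ 3 $ 2 = w * z" "M z $ 3 $ 3 = z^3 - B + x" for z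
    by (simp_all add: M_def)
  have eq: "M (- z) $ 1 $ i * M z $ 2 $ j + M (- z) $ 2 $ i * M z $ 1 $ j + M (- z) $ 3 $ i * M z $ 3 $ j
      = ((- z)^3 - B) * (z^3 - B) * P_mat $ i $ j" if z: "norm z < \<delta>" for z i j
  proof -
    have M: "M z $ k $ l = g z $ k $ l * (z^3 - B)" if "norm z < \<delta>" for z k l
      unfolding M_def by (rule g[OF B[OF that], symmetric])
    have "P_mat $ i $ j = (transpose (g (- z)) ** P_mat ** g z) $ i $ j"
      by (simp only: P[OF z])
    also have "\<dots> = g (- z) $ 1 $ i * g z $ 2 $ j + g (- z) $ 2 $ i * g z $ 1 $ j
        + g (- z) $ 3 $ i * g z $ 3 $ j"
      by (simp add: matrix_mult_3 P_components transpose_def)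
    finally have *: "P_mat $ i $ j = g (- z) $ 1 $ i * g z $ 2 $ j + g (- z) $ 2 $ i * g z $ 1 $ j
        + g (- z) $ 3 $ i * g z $ 3 $ j" .
    have "norm (- z) < \<delta>"
      using z by simp
    from M[OF this] M[OF z] show ?thesis
      unfolding * by (simp only: distrib_left mult_ac)
  qed
  note eqs = eq[of _ 1 1] eq[of _ 1 2] eq[of _ 1 3] eq[of _ 2 2] eq[of _ 2 3] eq[of _ 3 3]
  note eqs = eqs[unfolded M_components P_components]
  \<comment> \<open>From here on, each list holds the coefficients of left side minus right side of
    one entry of the matrix identity.\<close>
  have "[:0, 0, 0, 0, v\<^sup>2 - 2 * s:] = 0"
    by (rule poly_eq_0_if_vanishes_near_0[OF _ \<open>\<delta> > 0\<close>])
       (drule eqs(1), simp, algebra)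
  then show "v\<^sup>2 = 2 * s"
    by simp
  have "[:p * t - B * (p + t), 0, 0, p - t - s * q + v * w:] = 0"
    by (rule poly_eq_0_if_vanishes_near_0[OF _ \<open>\<delta> > 0\<close>])
       (drule eqs(2), simp, algebra)
  then show "p * t = B * (p + t)" "p - t - s * q + v * w = 0"
    by simp_all
  have "[:0, 0, p * u + v * x - B * (u + v) - s * r, 0, 0, v - u:] = 0"
    by (rule poly_eq_0_if_vanishes_near_0[OF _ \<open>\<delta> > 0\<close>])
       (drule eqs(3), simp, algebra)
  then show "u = v" "p * u + v * x = B * (u + v) + s * r"
    by (auto simp: algebra_simps)
  have "[:0, 0, 2 * q * (t - B) - w\<^sup>2:] = 0"
    by (rule poly_eq_0_if_vanishes_near_0[OF _ \<open>\<delta> > 0\<close>])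
       (drule eqs(4), simp, algebra)
  then show "2 * q * (t - B) = w\<^sup>2"
    by simp
  have "[:0, B * (w - r) + t * r - w * x, 0, 0, q * u - r - w:] = 0"
    by (rule poly_eq_0_if_vanishes_near_0[OF _ \<open>\<delta> > 0\<close>])
       (drule eqs(5), simp, algebra)
  then show "r + w = q * u" "B * (w - r) + t * r = w * x"
    by (simp_all add: algebra_simps)
  \<comment> \<open>The two mixed products, \<open>- r * u * z^3\<close> and
    \<open>u * r * z^3\<close>, cancel, leaving \<open>(x - B)^2 = B^2\<close>.\<close>
  have "[:x * (x - 2 * B):] = 0"
    by (rule poly_eq_0_if_vanishes_near_0[OF _ \<open>\<delta> > 0\<close>])
       (drule eqs(6), simp, algebra)
  then show "x * (x - 2 * B) = 0"
    by simp
qed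

section \<open>Solution of the quadratic equations\<close>

text \<open>The third row determines \<open>a\<close> and \<open>b\<close> through \<open>v\<close>
  and \<open>w\<close>. The equations then give \<open>t\<close>, and \<open>p\<close>,
  \<open>q\<close>, \<open>r\<close> follow on division by \<open>t - \<alpha>^3\<close>. The
  excluded values are those of the scalar element.\<close>

lemma equations_solution_rank_1:
  fixes p q r s t u v w x \<alpha> :: real
  assumes "\<alpha> \<noteq> 0"
    and eqs: "v\<^sup>2 = 2 * s" "p * t = \<alpha>^3 * (p + t)" "p - t - s * q + v * w = 0"
      "u = v" "p * u + v * x = \<alpha>^3 * (u + v) + s * r" "2 * q * (t - \<alpha>^3) = w\<^sup>2"
      "r + w = q * u" "\<alpha>^3 * (w - r) + t * r = w * x"
    and "x = 2 * \<alpha>^3"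
    and "\<not> (p = 2 * \<alpha>^3 \<and> t = 2 * \<alpha>^3 \<and> q = 0 \<and> r = 0 \<and> s = 0 \<and> u = 0 \<and> v = 0 \<and> w = 0)"
  obtains a b where "2 * a * b \<noteq> 1" "p = 2 * \<alpha>^3 * a * b / (2 * a * b - 1)"
    "q = 2 * \<alpha> * b\<^sup>2 / (2 * a * b - 1)" "r = 2 * \<alpha>\<^sup>2 * b / (2 * a * b - 1)"
    "s = 2 * \<alpha>\<^sup>2 * a\<^sup>2" "t = 2 * \<alpha>^3 * a * b" "u = 2 * \<alpha> * a" "v = 2 * \<alpha> * a" "w = 2 * \<alpha>\<^sup>2 * b"
proof -
  define a b where "a = v / (2 * \<alpha>)" and "b = w / (2 * \<alpha>\<^sup>2)"
  have ab: "v = 2 * \<alpha> * a" "w = 2 * \<alpha>\<^sup>2 * b"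
    using \<open>\<alpha> \<noteq> 0\<close> by (simp_all add: a_def b_def)
  \<comment> \<open>The second equation reads
    \<open>(p - \<alpha>^3) * (t - \<alpha>^3) = \<alpha>^6\<close>, so neither factor
    vanishes.\<close>
  have tc: "t - \<alpha>^3 \<noteq> 0"
  proof
    assume "t - \<alpha>^3 = 0"
    with eqs(2) have "\<alpha>^3 * \<alpha>^3 = 0"
      by algebra
    with \<open>\<alpha> \<noteq> 0\<close> show False
      by simp
  qed
  \<comment> \<open>Multiplying the fifth and seventh equations by \<open>t - \<alpha>^3\<close>
    eliminates \<open>p\<close>, \<open>q\<close> and \<open>r\<close>, because the other equations
    express their products with this factor.\<close>
  have "\<alpha>^3 * (v * (2 * t - v * w)) = 0"
    using eqs \<open>x = 2 * \<alpha>^3\<close> by algebra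
  moreover have "w * (2 * t - v * w) = 0"
    using eqs \<open>x = 2 * \<alpha>^3\<close> by algebra
  ultimately have cases: "2 * t = v * w \<or> v = 0 \<and> w = 0"
    using \<open>\<alpha> \<noteq> 0\<close> by auto
  have t: "2 * t = v * w"
  proof (rule ccontr)
    \<comment> \<open>Here \<open>v = w = 0\<close> but \<open>t \<noteq> 0\<close>, which forces
      \<open>p = t = 2 * \<alpha>^3\<close>: the scalar element.\<close>
    assume "2 * t \<noteq> v * w"
    with cases have vw: "v = 0" "w = 0" "t \<noteq> 0"
      by auto
    then have "s = 0" "q = 0"
      using eqs tc by auto
    then have "p = t" "r = 0"
      using eqs vw by auto
    then have "t = 2 * \<alpha>^3"
      using eqs(2) vw by simp
    then show False
      using assms \<open>s = 0\<close> \<open>q = 0\<close> \<open>p = t\<close> \<open>r = 0\<close> vw by simp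
  qed
  have t': "t = 2 * \<alpha>^3 * a * b"
    using t ab by algebra
  \<comment> \<open>Nonvanishing of \<open>t - \<alpha>^3\<close> thus becomes the condition that
    the line avoids lying in \<open>Delta0\<close>.\<close>
  have n: "t - \<alpha>^3 = \<alpha>^3 * (2 * a * b - 1)"
    using t' by algebra
  with tc have ne: "2 * a * b - 1 \<noteq> 0"
    by auto
  have "\<alpha>^3 * (p * (2 * a * b - 1)) = \<alpha>^3 * (2 * \<alpha>^3 * a * b)"
    using eqs(2) t' by algebra
  moreover have "2 * \<alpha>^3 * (q * (2 * a * b - 1)) = 2 * \<alpha>^3 * (2 * \<alpha> * b\<^sup>2)"
    using eqs(6) t' ab by algebra
  moreover have "\<alpha>^3 * (r * (2 * a * b - 1)) = \<alpha>^3 * (2 * \<alpha>\<^sup>2 * b)"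
    using eqs(8) \<open>x = 2 * \<alpha>^3\<close> t' ab by algebra
  moreover have "\<alpha>^3 \<noteq> 0" "2 * \<alpha>^3 \<noteq> 0"
    using \<open>\<alpha> \<noteq> 0\<close> by simp_all
  ultimately have "p * (2 * a * b - 1) = 2 * \<alpha>^3 * a * b" "q * (2 * a * b - 1) = 2 * \<alpha> * b\<^sup>2"
      "r * (2 * a * b - 1) = 2 * \<alpha>\<^sup>2 * b"
    by (simp_all only: mult_left_cancel not_False_eq_True)
  moreover have "2 * s = 2 * (2 * \<alpha>\<^sup>2 * a\<^sup>2)"
    using eqs(1) ab by algebra
  ultimately show thesis
    using ne t' ab eqs(4) by (intro that[of a b] eq_divide_imp) simp_all
qed

text \<open>The same elimination with \<open>x = 0\<close> gives
  \<open>2 * t - 4 * \<alpha>^3 = v * w\<close> instead of \<open>2 * t = v * w\<close>. The sign in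
  the choice of \<open>a\<close> follows the third row of \<open>h_elem\<close>, and the excluded
  values are those of the identity.\<close>

lemma equations_solution_rank_2:
  fixes p q r s t u v w x \<alpha> :: real
  assumes "\<alpha> \<noteq> 0"
    and eqs: "v\<^sup>2 = 2 * s" "p * t = \<alpha>^3 * (p + t)" "p - t - s * q + v * w = 0"
      "u = v" "p * u + v * x = \<alpha>^3 * (u + v) + s * r" "2 * q * (t - \<alpha>^3) = w\<^sup>2"
      "r + w = q * u" "\<alpha>^3 * (w - r) + t * r = w * x"
    and "x = 0"
    and "\<not> (p = 0 \<and> t = 0 \<and> q = 0 \<and> r = 0 \<and> s = 0 \<and> u = 0 \<and> v = 0 \<and> w = 0)"
  obtains a b where "2 * a * b \<noteq> 1" "p = 2 * \<alpha>^3 * (a * b - 1) / (2 * a * b - 1)"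
    "q = - 2 * \<alpha> * b\<^sup>2 / (2 * a * b - 1)" "r = 2 * \<alpha>\<^sup>2 * b / (2 * a * b - 1)"
    "s = 2 * \<alpha>\<^sup>2 * a\<^sup>2" "t = 2 * \<alpha>^3 * (1 - a * b)" "u = - 2 * \<alpha> * a" "v = - 2 * \<alpha> * a" "w = 2 * \<alpha>\<^sup>2 * b"
proof -
  define a b where "a = - v / (2 * \<alpha>)" and "b = w / (2 * \<alpha>\<^sup>2)"
  have ab: "v = - 2 * \<alpha> * a" "w = 2 * \<alpha>\<^sup>2 * b"
    using \<open>\<alpha> \<noteq> 0\<close> by (simp_all add: a_def b_def)
  have tc: "t - \<alpha>^3 \<noteq> 0"
  proof
    assume "t - \<alpha>^3 = 0"
    with eqs(2) have "\<alpha>^3 * \<alpha>^3 = 0"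
      by algebra
    with \<open>\<alpha> \<noteq> 0\<close> show False
      by simp
  qed
  have "\<alpha>^3 * (v * (2 * t - 4 * \<alpha>^3 - v * w)) = 0"
    using eqs \<open>x = 0\<close> by algebra
  moreover have "w * (2 * t - 4 * \<alpha>^3 - v * w) = 0"
    using eqs \<open>x = 0\<close> by algebra
  ultimately have cases: "2 * t - 4 * \<alpha>^3 = v * w \<or> v = 0 \<and> w = 0"
    using \<open>\<alpha> \<noteq> 0\<close> by auto
  have t: "2 * t - 4 * \<alpha>^3 = v * w"
  proof (rule ccontr)
    assume "2 * t - 4 * \<alpha>^3 \<noteq> v * w"
    with cases have vw: "v = 0" "w = 0" "t \<noteq> 2 * \<alpha>^3"
      by auto
    then have "s = 0" "q = 0"
      using eqs tc by auto
    then have "p = t" "r = 0"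
      using eqs vw by auto
    then have "t * (t - 2 * \<alpha>^3) = 0"
      using eqs(2) by (simp add: algebra_simps)
    then have "t = 0"
      using vw by simp
    then show False
      using assms \<open>s = 0\<close> \<open>q = 0\<close> \<open>p = t\<close> \<open>r = 0\<close> vw by simp
  qed
  have t': "t = 2 * \<alpha>^3 * (1 - a * b)"
    using t ab by algebra
  have n: "t - \<alpha>^3 = - (\<alpha>^3 * (2 * a * b - 1))"
    using t' by algebra
  with tc have ne: "2 * a * b - 1 \<noteq> 0"
    by auto
  have "\<alpha>^3 * (p * (2 * a * b - 1)) = \<alpha>^3 * (2 * \<alpha>^3 * (a * b - 1))"
    using eqs(2) t' by algebra
  moreover have "2 * \<alpha>^3 * (q * (2 * a * b - 1)) = 2 * \<alpha>^3 * (- 2 * \<alpha> * b\<^sup>2)"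
    using eqs(6) t' ab by algebra
  moreover have "\<alpha>^3 * (r * (2 * a * b - 1)) = \<alpha>^3 * (2 * \<alpha>\<^sup>2 * b)"
    using eqs(8) \<open>x = 0\<close> t' ab by algebra
  moreover have "\<alpha>^3 \<noteq> 0" "2 * \<alpha>^3 \<noteq> 0"
    using \<open>\<alpha> \<noteq> 0\<close> by simp_all
  ultimately have "p * (2 * a * b - 1) = 2 * \<alpha>^3 * (a * b - 1)" "q * (2 * a * b - 1) = - 2 * \<alpha> * b\<^sup>2"
      "r * (2 * a * b - 1) = 2 * \<alpha>\<^sup>2 * b"
    by (simp_all only: mult_left_cancel not_False_eq_True)
  moreover have "2 * s = 2 * (2 * \<alpha>\<^sup>2 * a\<^sup>2)"
    using eqs(1) ab by algebra
  ultimately show thesis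
    using ne t' ab eqs(4) by (intro that[of a b] eq_divide_imp) simp_all
qed

section \<open>Comparison with the explicit elements\<close>

text \<open>The coefficients appear as \<open>of_real\<close> of the solutions \<open>p\<close> to
  \<open>x\<close>, so that substituting these in the final proof makes both matrices literally
  equal.\<close>

lemma g_elem_component:
  assumes "z^3 \<noteq> complex_of_real \<alpha> ^ 3" "2 * a * b \<noteq> 1"
  shows "g_elem \<alpha> a b z $ i $ j = (vector
    [vector [z^3 - \<alpha>^3 + of_real (2 * \<alpha>^3 * a * b / (2 * a * b - 1)),
       of_real (2 * \<alpha> * b\<^sup>2 / (2 * a * b - 1)) * z\<^sup>2, of_real (2 * \<alpha>\<^sup>2 * b / (2 * a * b - 1)) * z],
     vector [of_real (2 * \<alpha>\<^sup>2 * a\<^sup>2) * z, z^3 - \<alpha>^3 + of_real (2 * \<alpha>^3 * a * b), of_real (2 * \<alpha> * a) * z\<^sup>2],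
     vector [of_real (2 * \<alpha> * a) * z\<^sup>2, of_real (2 * \<alpha>\<^sup>2 * b) * z, z^3 - \<alpha>^3 + of_real (2 * \<alpha>^3)]]
      :: complex^3^3) $ i $ j / (z^3 - \<alpha>^3)"
  using assms exhaust_3[of i] exhaust_3[of j]
  by (auto simp: g_elem_def matrix_mult_3 mat_def add_divide_distrib mult_ac) (simp add: divide_simps)

text \<open>The summand \<open>of_real 0\<close> stands for the coefficient \<open>x\<close> and
  keeps the shape of the general matrix.\<close>

lemma h_elem_component:
  assumes "z^3 \<noteq> complex_of_real \<alpha> ^ 3" "2 * a * b \<noteq> 1"
  shows "h_elem \<alpha> a b z $ i $ j = (vector
    [vector [z^3 - \<alpha>^3 + of_real (2 * \<alpha>^3 * (a * b - 1) / (2 * a * b - 1)),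
       of_real (- 2 * \<alpha> * b\<^sup>2 / (2 * a * b - 1)) * z\<^sup>2, of_real (2 * \<alpha>\<^sup>2 * b / (2 * a * b - 1)) * z],
     vector [of_real (2 * \<alpha>\<^sup>2 * a\<^sup>2) * z, z^3 - \<alpha>^3 + of_real (2 * \<alpha>^3 * (1 - a * b)), of_real (- 2 * \<alpha> * a) * z\<^sup>2],
     vector [of_real (- 2 * \<alpha> * a) * z\<^sup>2, of_real (2 * \<alpha>\<^sup>2 * b) * z, z^3 - \<alpha>^3 + of_real 0]]
      :: complex^3^3) $ i $ j / (z^3 - \<alpha>^3)"
  using assms exhaust_3[of i] exhaust_3[of j]
  by (auto simp: h_elem_def matrix_mult_3 mat_def add_divide_distrib mult_ac)

theorem corollary4p4:
  fixes g :: "complex \<Rightarrow> complex^3^3"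
  assumes "simplest_rational_element g"
  shows "\<exists>\<alpha> a b :: real. \<alpha> \<noteq> 0 \<and> \<not> real_line a b \<subseteq> Delta0 \<and>
    ((\<forall>z. z^3 \<noteq> complex_of_real \<alpha> ^ 3 \<longrightarrow> g z = g_elem \<alpha> a b z) \<or>
     (\<forall>z. z^3 \<noteq> complex_of_real \<alpha> ^ 3 \<longrightarrow> g z = h_elem \<alpha> a b z))"
proof -
  obtain B \<delta> and A0 A1 A2 :: "complex^3^3" where "B \<noteq> 0" "\<delta> > 0"
    and form: "\<And>z i j. z^3 \<noteq> B \<Longrightarrow> g z $ i $ j * (z^3 - B) =
       mat (z^3 - B) $ i $ j + (A0 $ i $ j + A1 $ i $ j * z + A2 $ i $ j * z\<^sup>2)"
    and nonzero: "A0 \<noteq> 0 \<or> A1 \<noteq> 0 \<or> A2 \<noteq> 0"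
    and B: "\<And>z. norm z < \<delta> \<Longrightarrow> z^3 \<noteq> B"
    and inv: "\<And>z. norm z < \<delta> \<Longrightarrow> invertible (g z)"
    and tau: "\<And>z. norm z < \<delta> \<Longrightarrow> tau (g (cnj z)) = g z"
    and sigma: "\<And>z. norm z < \<delta> \<Longrightarrow> sigma (g z) = g (eps * z)"
    and nonscalar: "\<not> (\<forall>z. z^3 \<noteq> B \<longrightarrow> g z = mat ((z^3 + B) / (z^3 - B)))"
    by (rule simplest_rational_element_form[OF assms]) (rule that; blast)
  \<comment> \<open>As \<open>eps\<close> has modulus 1, the disc is invariant and
    \<open>sigma\<close> can be iterated on it.\<close>
  have norm_eps: "norm (eps * z) < \<delta>" if "norm z < \<delta>" for z
    using that by (simp add: eps_def norm_mult)
  have sigma2: "sigma (sigma (g z)) = g (eps^2 * z)" if "norm z < \<delta>" for z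
    using sigma[OF that] sigma[OF norm_eps[OF that]] by (simp add: power2_eq_square mult.assoc)
  have inv_sigma: "invertible (sigma (g z))" "invertible (sigma (sigma (g z)))"
    if "norm z < \<delta>" for z
    using that by (simp_all only: sigma inv norm_eps)
  have D: "g (eps^2 * z) ** D_mat = D_mat ** g z" if "norm z < \<delta>" for z
    using sigma_sigma[OF inv inv_sigma(1)] that by (simp add: sigma2)
  have sigma3: "sigma (sigma (sigma (g z))) = g (- z)" if "norm z < \<delta>" for z
  proof -
    have "eps * (eps * (eps * z)) = eps^3 * z"
      by (simp add: power3_eq_cube mult.assoc)
    also have "\<dots> = - z"
      by (simp only: eps_power(1)) simp
    finally show ?thesis
      using that by (simp only: sigma norm_eps)
  qed
  have P: "transpose (g (- z)) ** P_mat ** g z = P_mat" if "norm z < \<delta>" for z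
    using sigma_sigma_sigma[OF inv inv_sigma] that by (simp only: sigma3)
  note pattern = twisted_coeff_pattern[OF \<open>\<delta> > 0\<close> form B D]
  note reals = real_coeffs[OF \<open>\<delta> > 0\<close> form B tau nonzero]
  obtain c where c: "B = of_real c"
    using reals(4) by (rule Reals_cases)
  \<comment> \<open>The given pole may be a nonreal cube root of \<open>B\<close>; the real cube
    root, available for either sign of \<open>c\<close>, replaces it.\<close>
  define \<alpha> where "\<alpha> = root 3 c"
  have \<alpha>: "\<alpha> \<noteq> 0" "c = \<alpha>^3"
    using \<open>B \<noteq> 0\<close> c by (simp_all add: \<alpha>_def odd_real_root_pow)
  note B_eq = c[unfolded \<alpha>(2)]
  define p q r where "p = Re (A0 $ 1 $ 1)" and "q = Re (A2 $ 1 $ 2)" and "r = Re (A1 $ 1 $ 3)"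
  define s t u where "s = Re (A1 $ 2 $ 1)" and "t = Re (A0 $ 2 $ 2)" and "u = Re (A2 $ 2 $ 3)"
  define v w x where "v = Re (A2 $ 3 $ 1)" and "w = Re (A1 $ 3 $ 2)" and "x = Re (A0 $ 3 $ 3)"
  have entries: "A0 $ 1 $ 1 = of_real p" "A2 $ 1 $ 2 = of_real q" "A1 $ 1 $ 3 = of_real r"
    "A1 $ 2 $ 1 = of_real s" "A0 $ 2 $ 2 = of_real t" "A2 $ 2 $ 3 = of_real u"
    "A2 $ 3 $ 1 = of_real v" "A1 $ 3 $ 2 = of_real w" "A0 $ 3 $ 3 = of_real x"
    using reals by (simp_all add: p_def q_def r_def s_def t_def u_def v_def w_def x_def)
  define M where "M z = (vector [
      vector [z^3 - B + of_real p, of_real q * z\<^sup>2, of_real r * z],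
      vector [of_real s * z, z^3 - B + of_real t, of_real u * z\<^sup>2],
      vector [of_real v * z\<^sup>2, of_real w * z, z^3 - B + of_real x]] :: complex^3^3)" for z
  have g: "g z $ i $ j * (z^3 - B) = M z $ i $ j" if "z^3 \<noteq> B" for z i j
    unfolding form[OF that] M_def
    using exhaust_3[of i] exhaust_3[of j]
    by (auto simp: mat_def entries pattern)
  note eqs_complex = P_condition_equations[OF \<open>\<delta> > 0\<close> P B g[unfolded M_def]]
  \<comment> \<open>The complex equations descend to the reals by injectivity of
    \<open>of_real\<close>.\<close>
  have eqs: "v\<^sup>2 = 2 * s" "p * t = \<alpha>^3 * (p + t)" "p - t - s * q + v * w = 0"
    "u = v" "p * u + v * x = \<alpha>^3 * (u + v) + s * r" "2 * q * (t - \<alpha>^3) = w\<^sup>2"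
    "r + w = q * u" "\<alpha>^3 * (w - r) + t * r = w * x" and x: "x * (x - 2 * \<alpha>^3) = 0"
    using eqs_complex
    unfolding of_real_eq_iff[symmetric, where 'a=complex] B_eq
    by (simp_all only: of_real_mult of_real_add of_real_diff of_real_power of_real_numeral of_real_0
        simp_thms implies_True_equals True_implies_equals triv_forall_equality)
  have g_eq: "g z $ i $ j = M z $ i $ j / (z^3 - of_real \<alpha> ^ 3)" if "z^3 \<noteq> of_real \<alpha> ^ 3" for z i j
    using g[of z i j] that by (simp add: B_eq eq_divide_eq)
  show ?thesis
  proof (cases "x = 0")
    case True
    \<comment> \<open>Otherwise all coefficients would vanish and \<open>g\<close> would be the
      identity, which has no poles.\<close>
    have "\<not> (p = 0 \<and> t = 0 \<and> q = 0 \<and> r = 0 \<and> s = 0 \<and> u = 0 \<and> v = 0 \<and> w = 0)"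
      using nonzero by (auto simp: vec_eq_iff forall_3 entries pattern True)
    from equations_solution_rank_2[OF \<alpha>(1) eqs True this]
    obtain a b where ab: "2 * a * b \<noteq> 1" "p = 2 * \<alpha>^3 * (a * b - 1) / (2 * a * b - 1)"
      "q = - 2 * \<alpha> * b\<^sup>2 / (2 * a * b - 1)" "r = 2 * \<alpha>\<^sup>2 * b / (2 * a * b - 1)"
      "s = 2 * \<alpha>\<^sup>2 * a\<^sup>2" "t = 2 * \<alpha>^3 * (1 - a * b)" "u = - 2 * \<alpha> * a" "v = - 2 * \<alpha> * a" "w = 2 * \<alpha>\<^sup>2 * b" .
    have "g z = h_elem \<alpha> a b z" if "z^3 \<noteq> of_real \<alpha> ^ 3" for z
      unfolding vec_eq_iff g_eq[OF that] h_elem_component[OF that ab(1)] M_def ab(2-) True B_eq of_real_power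
      by blast
    with \<alpha>(1) ab(1) show ?thesis
      unfolding real_line_not_subset_Delta0_iff by blast
  next
    case False
    with x have x: "x = 2 * \<alpha>^3"
      by simp
    have "\<not> (p = 2 * \<alpha>^3 \<and> t = 2 * \<alpha>^3 \<and> q = 0 \<and> r = 0 \<and> s = 0 \<and> u = 0 \<and> v = 0 \<and> w = 0)"
    proof
      \<comment> \<open>These values make the numerator of \<open>g - I\<close> equal to
        \<open>2 * B\<close> times the identity, which is the excluded scalar element.\<close>
      assume scalar: "p = 2 * \<alpha>^3 \<and> t = 2 * \<alpha>^3 \<and> q = 0 \<and> r = 0 \<and> s = 0 \<and> u = 0 \<and> v = 0 \<and> w = 0"
      have "g z = mat ((z^3 + B) / (z^3 - B))" if "z^3 \<noteq> B" for z
        using g_eq[of z] that scalar x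
        by (simp add: vec_eq_iff forall_3 M_def mat_def B_eq)
      with nonscalar show False
        by blast
    qed
    from equations_solution_rank_1[OF \<alpha>(1) eqs x this]
    obtain a b where ab: "2 * a * b \<noteq> 1" "p = 2 * \<alpha>^3 * a * b / (2 * a * b - 1)"
      "q = 2 * \<alpha> * b\<^sup>2 / (2 * a * b - 1)" "r = 2 * \<alpha>\<^sup>2 * b / (2 * a * b - 1)"
      "s = 2 * \<alpha>\<^sup>2 * a\<^sup>2" "t = 2 * \<alpha>^3 * a * b" "u = 2 * \<alpha> * a" "v = 2 * \<alpha> * a" "w = 2 * \<alpha>\<^sup>2 * b" .
    have "g z = g_elem \<alpha> a b z" if "z^3 \<noteq> of_real \<alpha> ^ 3" for z
      unfolding vec_eq_iff g_eq[OF that] g_elem_component[OF that ab(1)] M_def ab(2-) x B_eq of_real_power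
      by blast
    with \<alpha>(1) ab(1) show ?thesis
      unfolding real_line_not_subset_Delta0_iff by blast
  qed
qed

end
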